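(* Let $p$ be an odd rational prime, $\zeta$ a primitive $p$-th root of unity, $K=\mathbb{Q}(\zeta)$ with ring of algebraic integers $O_{K}=\mathbb{Z}[\zeta]$, and let $\sigma,\tau$ be any two different non-zero ring endomorphisms of $O_{K}$. Let $D:O_{K}\to O_{K}$ be a $\mathbb{Z}$-linear map with $D(1)=0$. Then $D$ is a $(\sigma,\tau)$-derivation if and only if for all $k\in\{1,2,\dots,p-2\}$ $$D(\zeta^{k})=\left(\sum_{(i,j)\in S_{k-1}}\sigma(\zeta^{i})\tau(\zeta^{j})\right)D(\zeta).$$
   Context: A $(\sigma,\tau)$-derivation of $O_{K}$ is a $\mathbb{Z}$-linear map $D:O_{K}\to O_{K}$ with $D(xy)=D(x)\tau(y)+\sigma(x)D(y)$ for all $x,y\in O_{K}$. For a non-negative integer $k$, $S_{k}$ is the set of all ordered pairs $(i,j)$ of non-negative integers with $i+j=k$. *)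

theory Defs
  imports
    Complex_Main
    "HOL-Computational_Algebra.Computational_Algebra"
    "HOL-Algebra.Generated_Fields"
    "HOL-Algebra.Algebraic_Closure_Type"
begin

definition primitive_root_of_unity :: "nat \<Rightarrow> complex \<Rightarrow> bool" where
  "primitive_root_of_unity n z \<longleftrightarrow> 0 < n \<and> z ^ n = 1 \<and> (\<forall>m. 0 < m \<and> m < n \<longrightarrow> z ^ m \<noteq> 1)"

text \<open>
  Number fields are subfields of the complex numbers. As \<open>generate_field\<close> always contains
  \<open>1\<close>, the field generated by \<open>z\<close> contains the rationals, so it is \<open>\<rat>(z)\<close>.
\<close>

definition rat_adjoin :: "complex \<Rightarrow> complex set" where
  "rat_adjoin z = generate_field (ring_of_type_algebra :: complex ring) {z}"

definition ring_of_integers :: "complex set \<Rightarrow> complex set" where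
  "ring_of_integers K = {x \<in> K. algebraic_int x}"

text \<open>
  Maps from a subring \<open>R\<close> of the complex numbers to itself are functions on \<open>complex\<close> of which
  only the values on \<open>R\<close> matter. A ring endomorphism is not required to preserve \<open>1\<close>, so that
  the zero map is one and being non-zero is a genuine condition.
\<close>

definition ring_endomorphism_on :: "complex set \<Rightarrow> (complex \<Rightarrow> complex) \<Rightarrow> bool" where
  "ring_endomorphism_on R f \<longleftrightarrow> f \<in> R \<rightarrow> R \<and>
     (\<forall>x\<in>R. \<forall>y\<in>R. f (x + y) = f x + f y) \<and>
     (\<forall>x\<in>R. \<forall>y\<in>R. f (x * y) = f x * f y)"

definition int_linear_on :: "complex set \<Rightarrow> (complex \<Rightarrow> complex) \<Rightarrow> bool" where
  "int_linear_on R D \<longleftrightarrow> D \<in> R \<rightarrow> R \<and>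
     (\<forall>x\<in>R. \<forall>y\<in>R. D (x + y) = D x + D y) \<and>
     (\<forall>n::int. \<forall>x\<in>R. D (of_int n * x) = of_int n * D x)"

definition twisted_derivation_on ::
    "complex set \<Rightarrow> (complex \<Rightarrow> complex) \<Rightarrow> (complex \<Rightarrow> complex) \<Rightarrow> (complex \<Rightarrow> complex) \<Rightarrow> bool" where
  "twisted_derivation_on R \<sigma> \<tau> D \<longleftrightarrow> int_linear_on R D \<and>
     (\<forall>x\<in>R. \<forall>y\<in>R. D (x * y) = D x * \<tau> y + \<sigma> x * D y)"

definition pairs_with_sum :: "nat \<Rightarrow> (nat \<times> nat) set" where
  "pairs_with_sum k = {(i, j). i + j = k}"

end

theory Submission
  imports Defs "Jordan_Normal_Form.Char_Poly"
begin

text \<open>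
  Put \<open>R = ring_of_integers K\<close>. Both directions go through the single identity
  \<open>(\<sigma> \<zeta> - \<tau> \<zeta>) * D x = (\<sigma> x - \<tau> x) * D \<zeta>\<close> for all \<open>x \<in> R\<close>, in which
  \<open>\<sigma> \<zeta> \<noteq> \<tau> \<zeta>\<close>. A derivation satisfies it because \<open>D (x * \<zeta>) = D (\<zeta> * x)\<close>, and conversely the
  identity makes \<open>D\<close> a multiple of \<open>\<sigma> - \<tau>\<close>. On \<open>x = \<zeta> ^ k\<close> it is the stated formula multiplied by
  \<open>\<sigma> \<zeta> - \<tau> \<zeta>\<close>; from \<open>k \<le> p - 2\<close> it extends to all powers of \<open>\<zeta>\<close> by
  \<open>1 + \<zeta> + \<dots> + \<zeta> ^ (p - 1) = 0\<close> and \<open>\<zeta> ^ p = 1\<close>. To pass from powers of \<open>\<zeta>\<close> to \<open>R\<close> the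
  equality \<open>R = \<int>[\<zeta>]\<close> is not needed: as \<open>\<complex>\<close> is torsion-free, it is enough that every
  element of \<open>\<rat>(\<zeta>)\<close> has a nonzero integer multiple in \<open>\<int>[\<zeta>]\<close>.
\<close>

section \<open>Algebraic integers\<close>

text \<open>Spans are the additive subgroups generated by a set. In particular the span of the
  powers of \<open>z\<close> is the ring \<int>[z], and this is how that ring appears
  throughout.\<close>

interpretation zmod: Modules.module "\<lambda>(n::int) (x::complex). of_int n * x"
  by unfold_locales (auto simp: algebra_simps)

lemma zspan_of_int_mult: "x \<in> zmod.span S \<Longrightarrow> of_int n * x \<in> zmod.span S"
  by (rule zmod.span_scale)

text \<open>Multiplication by \<open>x\<close> is \<int>-linear, so stability need only be tested on
  generators.\<close>

lemma zspan_mult_left_closed: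
  assumes "\<And>s. s \<in> S \<Longrightarrow> x * s \<in> zmod.span S" and "y \<in> zmod.span S"
  shows "x * y \<in> zmod.span S"
  using assms(2)
proof (induction rule: zmod.span_induct_alt)
  case (step c s y)
  have "x * (of_int c * s + y) = of_int c * (x * s) + x * y"
    by (simp add: algebra_simps)
  then show ?case
    using step assms(1) by (auto intro!: zmod.span_add zspan_of_int_mult)
qed (simp add: zmod.span_zero)

text \<open>The matrix of multiplication by \<open>x\<close> has integer entries and eigenvalue \<open>x\<close>.\<close>

lemma algebraic_int_if_stable_zspan:
  assumes "finite S" and "\<exists>s\<in>S. s \<noteq> 0" and stable: "\<And>s. s \<in> S \<Longrightarrow> x * s \<in> zmod.span S"
  shows "algebraic_int x"
proof -
  define n where "n = card S"
  obtain h where h: "bij_betw h {0..<n} S"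
    using ex_bij_betw_nat_finite[OF assms(1)] by (auto simp: n_def)
  have "\<forall>s\<in>S. \<exists>u. x * s = (\<Sum>t\<in>S. of_int (u t) * t)"
    using stable zmod.span_finite[OF assms(1)] by blast
  then obtain c where c: "\<And>s. s \<in> S \<Longrightarrow> x * s = (\<Sum>t\<in>S. of_int (c s t) * t)"
    by metis
  define B where "B = mat n n (\<lambda>(i, j). c (h i) (h j))"
  define A where "A = (map_mat of_int B :: complex mat)"
  define v where "v = vec n h"
  have B: "B \<in> carrier_mat n n" and A: "A \<in> carrier_mat n n"
    by (auto simp: A_def B_def)
  have hS: "h i \<in> S" if "i < n" for i
    using that h by (auto simp: bij_betw_def)
  obtain i where i: "i < n" "h i \<noteq> 0"
    using assms(2) h by (auto simp: bij_betw_def)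
  have "v \<noteq> 0\<^sub>v n"
  proof
    assume "v = 0\<^sub>v n"
    then have "v $ i = 0\<^sub>v n $ i" by simp
    with i show False by (simp add: v_def)
  qed
  moreover have "A *\<^sub>v v = x \<cdot>\<^sub>v v"
  proof (rule eq_vecI)
    fix i assume "i < dim_vec (x \<cdot>\<^sub>v v)"
    then have i: "i < n" by (simp add: v_def)
    have "(A *\<^sub>v v) $ i = (\<Sum>j = 0..<n. of_int (c (h i) (h j)) * h j)"
      using i by (simp add: A_def B_def v_def scalar_prod_def)
    also have "\<dots> = (\<Sum>t\<in>S. of_int (c (h i) t) * t)"
      using h by (rule sum.reindex_bij_betw)
    also have "\<dots> = x * h i" using c[OF hS[OF i]] by simp
    finally show "(A *\<^sub>v v) $ i = (x \<cdot>\<^sub>v v) $ i" using i by (simp add: v_def)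
  qed (auto simp: A_def B_def v_def)
  ultimately have "eigenvector A v x"
    unfolding eigenvector_def using A by (auto simp: v_def)
  then have "poly (char_poly A) x = 0"
    using eigenvalue_root_char_poly[OF A] by (auto simp: eigenvalue_def)
  \<comment> \<open>Taking characteristic polynomials commutes with the embedding of \<int>, so
    \<open>x\<close> is a root of a monic integer polynomial.\<close>
  moreover have "char_poly A = map_poly of_int (char_poly B)"
    unfolding A_def by (rule of_int_hom.char_poly_hom[OF B])
  moreover have "lead_coeff (char_poly B) = 1"
    using degree_monic_char_poly[OF B] by simp
  ultimately show ?thesis
    unfolding algebraic_int_altdef_ipoly by auto
qed

text \<open>A monic integer equation is solved for its leading power, \<open>m\<close> being its
  degree.\<close>

lemma algebraic_int_power_in_zspan:
  assumes "algebraic_int (x::complex)"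
  obtains m where "0 < m" and "x ^ m \<in> zmod.span ((^) x ` {..<m})"
proof -
  from assms obtain q where q: "lead_coeff q = 1" "\<forall>i. coeff q i \<in> \<int>" "poly q x = 0"
    by (auto elim: algebraic_int.cases)
  define m where "m = degree q"
  \<comment> \<open>A monic constant polynomial is 1, which has no root.\<close>
  have "m \<noteq> 0"
  proof
    assume "m = 0"
    then obtain c where "q = [:c:]" by (metis degree_eq_zeroE m_def)
    with q show False by (auto split: if_splits)
  qed
  have "(\<Sum>i\<le>m. coeff q i * x ^ i) = 0"
    using q(3) by (simp add: poly_altdef m_def)
  then have "(\<Sum>i<m. coeff q i * x ^ i) + x ^ m = 0"
    using q(1) by (simp add: m_def lessThan_Suc_atMost [symmetric])
  then have eq: "x ^ m = - (\<Sum>i<m. coeff q i * x ^ i)"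
    by (metis add.commute add_eq_0_iff)
  have "coeff q i * x ^ i \<in> zmod.span ((^) x ` {..<m})" if "i < m" for i
  proof -
    obtain c where "coeff q i = of_int c" using q(2) by (auto elim: Ints_cases)
    moreover have "x ^ i \<in> zmod.span ((^) x ` {..<m})"
      using that by (intro zmod.span_base) auto
    ultimately show ?thesis by (auto intro: zspan_of_int_mult)
  qed
  then have "x ^ m \<in> zmod.span ((^) x ` {..<m})"
    unfolding eq by (intro zmod.span_neg zmod.span_sum) auto
  with \<open>m \<noteq> 0\<close> show ?thesis using that by blast
qed

text \<open>The monomials \<open>x ^ i * y ^ j\<close> with \<open>i < m\<close> and
  \<open>j < n\<close> work: multiplication by \<open>x\<close> or \<open>y\<close> shifts one
  exponent, and an exponent reaching its bound is rewritten through lower powers. The element 1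
  supplies the nonzero generator needed by the eigenvalue criterion.\<close>

lemma algebraic_int_stable_zspan_pair:
  assumes "algebraic_int (x::complex)" and "algebraic_int y"
  obtains S where "finite S" and "1 \<in> S"
    and "\<And>s. s \<in> S \<Longrightarrow> x * s \<in> zmod.span S" and "\<And>s. s \<in> S \<Longrightarrow> y * s \<in> zmod.span S"
proof -
  obtain m where m: "0 < m" "x ^ m \<in> zmod.span ((^) x ` {..<m})"
    using algebraic_int_power_in_zspan[OF assms(1)] .
  obtain n where n: "0 < n" "y ^ n \<in> zmod.span ((^) y ` {..<n})"
    using algebraic_int_power_in_zspan[OF assms(2)] .
  define S where "S = (\<lambda>(i, j). x ^ i * y ^ j) ` ({..<m} \<times> {..<n})"
  have base: "x ^ i * y ^ j \<in> zmod.span S" if "i < m" "j < n" for i j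
    using that by (intro zmod.span_base) (auto simp: S_def)
  have x: "w * y ^ j \<in> zmod.span S" if "w \<in> zmod.span ((^) x ` {..<m})" "j < n" for w j
    using that(1)
  proof (induction rule: zmod.span_induct_alt)
    case (step c s w)
    then have "of_int c * (s * y ^ j) + w * y ^ j \<in> zmod.span S"
      using base that(2) by (auto intro!: zmod.span_add zspan_of_int_mult)
    then show ?case by (simp add: algebra_simps)
  qed (simp add: zmod.span_zero)
  have y: "x ^ i * w \<in> zmod.span S" if "w \<in> zmod.span ((^) y ` {..<n})" "i < m" for w i
    using that(1)
  proof (induction rule: zmod.span_induct_alt)
    case (step c s w)
    then have "of_int c * (x ^ i * s) + x ^ i * w \<in> zmod.span S"
      using base that(2) by (auto intro!: zmod.span_add zspan_of_int_mult)
    then show ?case by (simp add: algebra_simps)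
  qed (simp add: zmod.span_zero)
  have "x ^ Suc i * y ^ j \<in> zmod.span S" if "i < m" "j < n" for i j
    using base[of "Suc i" j] x[OF m(2)] that by (cases "Suc i = m") auto
  moreover have "x ^ i * y ^ Suc j \<in> zmod.span S" if "i < m" "j < n" for i j
    using base[of i "Suc j"] y[OF n(2)] that by (cases "Suc j = n") auto
  moreover have "1 \<in> S"
    using m(1) n(1) by (auto simp: S_def intro!: image_eqI[of _ _ "(0, 0)"])
  ultimately show ?thesis
    by (intro that[of S]) (auto simp: S_def mult_ac)
qed

section \<open>Sums and products of algebraic integers\<close>

text \<open>A span stable under both \<open>x\<close> and \<open>y\<close> is stable under their sum
  and, by composing the two multiplications, under their product.\<close>

lemma algebraic_int_add:
  assumes "algebraic_int (x::complex)" and "algebraic_int y"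
  shows "algebraic_int (x + y)"
proof -
  obtain S where S: "finite S" "1 \<in> S" "\<And>s. s \<in> S \<Longrightarrow> x * s \<in> zmod.span S"
      "\<And>s. s \<in> S \<Longrightarrow> y * s \<in> zmod.span S"
    using algebraic_int_stable_zspan_pair[OF assms] by blast
  show ?thesis
    by (rule algebraic_int_if_stable_zspan[OF S(1)])
      (use S in \<open>auto simp: distrib_right intro!: zmod.span_add bexI[of _ 1]\<close>)
qed

lemma algebraic_int_mult:
  assumes "algebraic_int (x::complex)" and "algebraic_int y"
  shows "algebraic_int (x * y)"
proof -
  obtain S where S: "finite S" "1 \<in> S" "\<And>s. s \<in> S \<Longrightarrow> x * s \<in> zmod.span S"
      "\<And>s. s \<in> S \<Longrightarrow> y * s \<in> zmod.span S"
    using algebraic_int_stable_zspan_pair[OF assms] by blast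
  show ?thesis
    by (rule algebraic_int_if_stable_zspan[OF S(1)])
      (use S in \<open>auto simp: mult.assoc intro!: zspan_mult_left_closed[OF S(3)] bexI[of _ 1]\<close>)
qed

section \<open>The field generated by an algebraic integer\<close>

text \<open>Field generation is phrased for ring records, so inverse and negation in the record must
  be identified with those of the type class.\<close>

lemma inv_ring_of_type_algebra:
  assumes "(x::'a::field) \<noteq> 0"
  shows "inv\<^bsub>ring_of_type_algebra\<^esub> x = inverse x"
proof -
  interpret F: field "ring_of_type_algebra :: 'a ring"
    by (rule field_from_type_algebra)
  show ?thesis
    by (rule F.comm_inv_char) (use assms in \<open>auto simp: ring_of_type_algebra_def\<close>)
qed

lemma uminus_ring_of_type_algebra: "\<ominus>\<^bsub>ring_of_type_algebra\<^esub> x = - (x::'a::field)"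
proof -
  interpret F: field "ring_of_type_algebra :: 'a ring"
    by (rule field_from_type_algebra)
  show ?thesis
    by (rule F.minus_equality) (auto simp: ring_of_type_algebra_def)
qed

lemma rat_adjoin_one: "1 \<in> rat_adjoin z"
  using generate_field.one[of "ring_of_type_algebra :: complex ring" "{z}"]
  by (simp add: rat_adjoin_def ring_of_type_algebra_def)

lemma rat_adjoin_gen: "z \<in> rat_adjoin z"
  unfolding rat_adjoin_def by (rule generate_field.incl) simp

lemma rat_adjoin_uminus: "x \<in> rat_adjoin z \<Longrightarrow> - x \<in> rat_adjoin z"
  using generate_field.a_inv[of x "ring_of_type_algebra :: complex ring" "{z}"]
  by (simp add: rat_adjoin_def uminus_ring_of_type_algebra)

lemma rat_adjoin_add: "x \<in> rat_adjoin z \<Longrightarrow> y \<in> rat_adjoin z \<Longrightarrow> x + y \<in> rat_adjoin z"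
  using generate_field.eng_add[of x "ring_of_type_algebra :: complex ring" "{z}" y]
  by (simp add: rat_adjoin_def ring_of_type_algebra_def)

lemma rat_adjoin_mult: "x \<in> rat_adjoin z \<Longrightarrow> y \<in> rat_adjoin z \<Longrightarrow> x * y \<in> rat_adjoin z"
  using generate_field.eng_mult[of x "ring_of_type_algebra :: complex ring" "{z}" y]
  by (simp add: rat_adjoin_def ring_of_type_algebra_def)

section \<open>Denominators of elements of \<rat>(z) relative to \<int>[z]\<close>

text \<open>A power of \<open>z\<close> maps the span into itself by shifting exponents. Applying
  this to \<open>x\<close>, then swapping factors, lets \<open>x\<close> act on the span.\<close>

lemma zspan_powers_mult:
  assumes "x \<in> zmod.span (range ((^) z))" and "y \<in> zmod.span (range ((^) z))"
  shows "x * y \<in> zmod.span (range ((^) z))"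
proof (rule zspan_mult_left_closed[OF _ assms(2)])
  fix s assume "s \<in> range ((^) z)"
  then have "s * x \<in> zmod.span (range ((^) z))"
    by (intro zspan_mult_left_closed[OF _ assms(1)] zmod.span_base)
      (auto simp: power_add [symmetric])
  then show "x * s \<in> zmod.span (range ((^) z))" by (simp add: mult.commute)
qed

lemma zspan_powers_algebraic_int:
  assumes "algebraic_int z" and "x \<in> zmod.span (range ((^) z))"
  shows "algebraic_int x"
  using assms(2)
proof (induction rule: zmod.span_induct_alt)
  case (step c s x)
  have "algebraic_int (z ^ k)" for k
    by (induction k) (auto intro: algebraic_int_mult assms(1))
  with step show ?case by (auto intro!: algebraic_int_add algebraic_int_mult)
qed simp

lemma zspan_powers_ipoly: "poly (map_poly of_int q) x \<in> zmod.span (range ((^) x))"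
  unfolding poly_altdef
  by (intro zmod.span_sum) (simp add: zspan_of_int_mult zmod.span_base)

text \<open>Since \<open>x\<close> is nonzero, it is a root of an integer polynomial
  \<open>q = c + X * r\<close> with \<open>c\<close> nonzero. Dividing the equation by
  \<open>x\<close> gives \<open>- c * inverse x = r(x)\<close>, which lies in \<int>[x] and so in
  \<int>[z].\<close>

lemma zspan_powers_inverse:
  assumes "algebraic_int z" and x: "x \<in> zmod.span (range ((^) z))" and "x \<noteq> 0"
  shows "\<exists>n::int. n \<noteq> 0 \<and> of_int n * inverse x \<in> zmod.span (range ((^) z))"
proof -
  have "algebraic x"
    using zspan_powers_algebraic_int[OF assms(1,2)] by auto
  then obtain q where q: "coeff q 0 \<noteq> 0" "poly (map_poly of_int q) x = 0"
    using algebraicE'_nonzero[OF _ assms(3)] by blast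
  obtain c r where cr: "q = pCons c r" by (cases q)
  have "c \<noteq> 0" using q(1) cr by simp
  have "poly (map_poly of_int q) x = of_int c + x * poly (map_poly of_int r) x"
    by (simp add: cr of_int_hom.map_poly_pCons_hom)
  then have "of_int (- c) * inverse x = poly (map_poly of_int r) x"
    using q(2) assms(3) by (simp add: field_simps add_eq_0_iff2)
  moreover have "zmod.span (range ((^) x)) \<subseteq> zmod.span (range ((^) z))"
  proof (rule zmod.span_minimal)
    have "x ^ k \<in> zmod.span (range ((^) z))" for k
    proof (induction k)
      case 0
      then show ?case by (auto intro!: zmod.span_base image_eqI[of _ _ 0])
    qed (auto intro: zspan_powers_mult x)
    then show "range ((^) x) \<subseteq> zmod.span (range ((^) z))" by blast
  qed (rule zmod.subspace_span)
  ultimately have "of_int (- c) * inverse x \<in> zmod.span (range ((^) z))"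
    using zspan_powers_ipoly[of r x] by auto
  with \<open>c \<noteq> 0\<close> show ?thesis by (intro exI[of _ "- c"]) simp
qed

text \<open>The elements that have such a multiple are closed under the field operations. Common
  denominators handle sums and products; inverses rest on
  \<open>zspan_powers_inverse\<close>.\<close>

lemma rat_adjoin_denominator:
  assumes "algebraic_int z" and "x \<in> rat_adjoin z"
  shows "\<exists>n::int. n \<noteq> 0 \<and> of_int n * x \<in> zmod.span (range ((^) z))"
proof -
  let ?M = "zmod.span (range ((^) z))"
  show ?thesis
    using assms(2) unfolding rat_adjoin_def
  proof (induction rule: generate_field.induct)
    case one
    have "1 \<in> ?M" by (auto intro!: zmod.span_base image_eqI[of _ _ 0])
    then show ?case
      by (intro exI[of _ 1]) (simp add: ring_of_type_algebra_def)
  next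
    case (incl h)
    then show ?case
      by (auto intro!: exI[of _ 1] zmod.span_base image_eqI[of _ _ 1])
  next
    case (a_inv h)
    then obtain n where "n \<noteq> 0" "of_int n * h \<in> ?M" by blast
    then show ?case
      using zmod.span_neg[of "of_int n * h"]
      by (auto simp: uminus_ring_of_type_algebra intro!: exI[of _ n])
  next
    case (m_inv h)
    have h0: "h \<noteq> 0" using m_inv(2) by (simp add: ring_of_type_algebra_def)
    from m_inv obtain n where n: "n \<noteq> 0" "of_int n * h \<in> ?M" by blast
    then obtain m where m: "m \<noteq> 0" "of_int m * inverse (of_int n * h) \<in> ?M"
      using zspan_powers_inverse[OF assms(1), of "of_int n * h"] h0 by auto
    \<comment> \<open>The extra factor \<open>n\<close> cancels the \<open>n\<close> inside the
      inverse, so \<open>m\<close> is a denominator for \<open>inverse h\<close>.\<close>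
    from zspan_of_int_mult[OF m(2), of n] have "of_int m * inverse h \<in> ?M"
      using n(1) h0 by (simp add: field_simps)
    with m(1) h0 show ?case by (auto simp: inv_ring_of_type_algebra)
  next
    case (eng_add x y)
    then obtain m n where mn: "m \<noteq> 0" "of_int m * x \<in> ?M" "n \<noteq> 0" "of_int n * y \<in> ?M"
      by blast
    have "of_int n * (of_int m * x) + of_int m * (of_int n * y) \<in> ?M"
      by (rule zmod.span_add[OF zspan_of_int_mult[OF mn(2)] zspan_of_int_mult[OF mn(4)]])
    then have "of_int (m * n) * (x + y) \<in> ?M" by (simp add: algebra_simps)
    with mn show ?case
      by (intro exI[of _ "m * n"]) (simp add: ring_of_type_algebra_def)
  next
    case (eng_mult x y)
    then obtain m n where mn: "m \<noteq> 0" "of_int m * x \<in> ?M" "n \<noteq> 0" "of_int n * y \<in> ?M"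
      by blast
    have "(of_int m * x) * (of_int n * y) \<in> ?M"
      by (rule zspan_powers_mult[OF mn(2,4)])
    then have "of_int (m * n) * (x * y) \<in> ?M" by (simp add: mult_ac)
    with mn show ?case
      by (intro exI[of _ "m * n"]) (simp add: ring_of_type_algebra_def)
  qed
qed

lemma ring_of_integers_gen: "algebraic_int z \<Longrightarrow> z \<in> ring_of_integers (rat_adjoin z)"
  by (simp add: ring_of_integers_def rat_adjoin_gen)

lemma ring_of_integers_one: "1 \<in> ring_of_integers (rat_adjoin z)"
  by (simp add: ring_of_integers_def rat_adjoin_one)

lemma ring_of_integers_uminus:
  "x \<in> ring_of_integers (rat_adjoin z) \<Longrightarrow> - x \<in> ring_of_integers (rat_adjoin z)"
  by (auto simp: ring_of_integers_def rat_adjoin_uminus)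

lemma ring_of_integers_add:
  "\<lbrakk>x \<in> ring_of_integers (rat_adjoin z); y \<in> ring_of_integers (rat_adjoin z)\<rbrakk>
    \<Longrightarrow> x + y \<in> ring_of_integers (rat_adjoin z)"
  by (auto simp: ring_of_integers_def rat_adjoin_add algebraic_int_add)

lemma ring_of_integers_mult:
  "\<lbrakk>x \<in> ring_of_integers (rat_adjoin z); y \<in> ring_of_integers (rat_adjoin z)\<rbrakk>
    \<Longrightarrow> x * y \<in> ring_of_integers (rat_adjoin z)"
  by (auto simp: ring_of_integers_def rat_adjoin_mult algebraic_int_mult)

section \<open>Twisted derivations\<close>

lemma additive_on_of_int_mult:
  fixes f :: "complex \<Rightarrow> complex"
  assumes R: "zmod.subspace R" and add: "\<And>x y. x \<in> R \<Longrightarrow> y \<in> R \<Longrightarrow> f (x + y) = f x + f y"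
    and "x \<in> R"
  shows "f (of_int n * x) = of_int n * f x"
proof -
  have mem: "of_int k * x \<in> R" for k :: int
    using zmod.subspace_scale[OF R \<open>x \<in> R\<close>] .
  have zero: "f 0 = 0"
    using add[of 0 0] zmod.subspace_0[OF R] by simp
  show ?thesis
  proof (induction n rule: int_induct[where k = 0])
    case (step1 i)
    then show ?case using add[OF mem[of i] \<open>x \<in> R\<close>] by (simp add: algebra_simps)
  next
    case (step2 i)
    then show ?case
      using add[OF mem[of "i - 1"] \<open>x \<in> R\<close>] by (simp add: algebra_simps)
  qed (simp add: zero)
qed

lemma ring_endomorphism_on_int_linear:
  "zmod.subspace R \<Longrightarrow> ring_endomorphism_on R f \<Longrightarrow> int_linear_on R f"
  using additive_on_of_int_mult[of R f]
  by (auto simp: ring_endomorphism_on_def int_linear_on_def)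

text \<open>Agreement spreads from \<open>S\<close> to its span by linearity. At \<open>x\<close> it
  then holds after multiplication by a nonzero integer, which can be cancelled in
  \<complex>.\<close>

lemma int_linear_on_agree:
  assumes R: "zmod.subspace R" and f: "int_linear_on R f" and g: "int_linear_on R g"
    and "S \<subseteq> R" and eq: "\<And>s. s \<in> S \<Longrightarrow> f s = g s"
    and "x \<in> R" and "\<exists>n::int. n \<noteq> 0 \<and> of_int n * x \<in> zmod.span S"
  shows "f x = g x"
proof -
  have span: "f y = g y" if "y \<in> zmod.span S" for y
  proof -
    \<comment> \<open>Membership in \<open>R\<close> is carried along because linearity is available
      only on \<open>R\<close>.\<close>
    have "y \<in> R \<and> f y = g y"
      using that
    proof (induction rule: zmod.span_induct_alt)
      case base
      have "h (of_int 0 * 0) = of_int 0 * h 0" if "int_linear_on R h" for h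
        using that zmod.subspace_0[OF R] unfolding int_linear_on_def by blast
      from this[OF f] this[OF g] show ?case using zmod.subspace_0[OF R] by simp
    next
      case (step c s y)
      then have "s \<in> R" "of_int c * s \<in> R"
        using \<open>S \<subseteq> R\<close> zmod.subspace_scale[OF R] by auto
      then show ?case
        using step eq f g zmod.subspace_add[OF R] by (simp add: int_linear_on_def)
    qed
    then show ?thesis ..
  qed
  obtain n :: int where n: "n \<noteq> 0" "of_int n * x \<in> zmod.span S" using assms(7) by blast
  have "of_int n * f x = of_int n * g x"
    using span[OF n(2)] f g \<open>x \<in> R\<close> by (simp add: int_linear_on_def)
  then show ?thesis using n(1) by simp
qed

text \<open>A nonzero value \<open>f x\<close> can be cancelled from
  \<open>f x = f x * f 1\<close>.\<close>

lemma ring_endomorphism_on_one: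
  assumes "ring_endomorphism_on R f" and "1 \<in> R" and "\<exists>x\<in>R. f x \<noteq> 0"
  shows "f 1 = 1"
proof -
  obtain x where x: "x \<in> R" "f x \<noteq> 0" using assms(3) by blast
  have "f (x * 1) = f x * f 1"
    using assms x(1) unfolding ring_endomorphism_on_def by blast
  then show ?thesis using x(2) by simp
qed

lemma ring_endomorphism_on_power:
  assumes "ring_endomorphism_on R f" and "f 1 = 1" and "x \<in> R" and "\<And>k::nat. x ^ k \<in> R"
  shows "f (x ^ k) = f x ^ k"
  by (induction k) (use assms in \<open>auto simp: ring_endomorphism_on_def\<close>)

lemma twisted_derivation_on_iff_proportional:
  assumes endo: "ring_endomorphism_on R \<sigma>" "ring_endomorphism_on R \<tau>"
    and D: "int_linear_on R D" and z: "z \<in> R" "\<sigma> z \<noteq> \<tau> z"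
    and mult: "\<And>x y. x \<in> R \<Longrightarrow> y \<in> R \<Longrightarrow> x * y \<in> R"
  shows "twisted_derivation_on R \<sigma> \<tau> D \<longleftrightarrow>
    (\<forall>x\<in>R. (\<sigma> z - \<tau> z) * D x = (\<sigma> x - \<tau> x) * D z)"
proof
  assume deriv: "twisted_derivation_on R \<sigma> \<tau> D"
  show "\<forall>x\<in>R. (\<sigma> z - \<tau> z) * D x = (\<sigma> x - \<tau> x) * D z"
  proof
    fix x assume "x \<in> R"
    then have "D (x * z) = D x * \<tau> z + \<sigma> x * D z" "D (z * x) = D z * \<tau> x + \<sigma> z * D x"
      using deriv z(1) by (auto simp: twisted_derivation_on_def)
    then show "(\<sigma> z - \<tau> z) * D x = (\<sigma> x - \<tau> x) * D z"
      by (simp add: algebra_simps)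
  qed
next
  assume eq: "\<forall>x\<in>R. (\<sigma> z - \<tau> z) * D x = (\<sigma> x - \<tau> x) * D z"
  have "D (x * y) = D x * \<tau> y + \<sigma> x * D y" if xy: "x \<in> R" "y \<in> R" for x y
  proof -
    have "(\<sigma> z - \<tau> z) * D (x * y) = (\<sigma> x * \<sigma> y - \<tau> x * \<tau> y) * D z"
      using eq mult xy endo by (auto simp: ring_endomorphism_on_def)
    \<comment> \<open>The difference \<sigma> - \<tau> itself obeys the twisted Leibniz rule, as
      inserting the mixed term \<open>\<sigma> x * \<tau> y\<close> shows.\<close>
    also have "\<dots> = ((\<sigma> x - \<tau> x) * D z) * \<tau> y + \<sigma> x * ((\<sigma> y - \<tau> y) * D z)"
      by (simp add: algebra_simps)
    also have "\<dots> = (\<sigma> z - \<tau> z) * D x * \<tau> y + \<sigma> x * ((\<sigma> z - \<tau> z) * D y)"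
      using eq xy by simp
    also have "\<dots> = (\<sigma> z - \<tau> z) * (D x * \<tau> y + \<sigma> x * D y)"
      by (simp add: algebra_simps)
    finally show ?thesis using z(2) by simp
  qed
  with D show "twisted_derivation_on R \<sigma> \<tau> D" by (simp add: twisted_derivation_on_def)
qed

section \<open>Identities for sums of powers\<close>

text \<open>The classical factorisation of a difference of powers, with each pair parametrised by
  its first coordinate.\<close>

lemma pairs_with_sum_diff_power:
  fixes a b :: "'a::comm_ring_1"
  shows "(a - b) * (\<Sum>(i, j)\<in>pairs_with_sum k. a ^ i * b ^ j) = a ^ Suc k - b ^ Suc k"
proof -
  have "pairs_with_sum k = (\<lambda>i. (i, k - i)) ` {..<Suc k}"
    by (auto simp: pairs_with_sum_def image_iff)
  moreover have "inj_on (\<lambda>i. (i, k - i)) {..<Suc k}"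
    by (auto simp: inj_on_def)
  ultimately show ?thesis
    unfolding diff_power_eq_sum by (simp add: sum.reindex)
qed

lemma primitive_root_of_unity_sum_powers:
  assumes "primitive_root_of_unity n z" and "1 < n"
  shows "(\<Sum>k<n. z ^ k) = 0"
proof -
  have "z ^ n = 1" "z ^ 1 \<noteq> 1"
    using assms unfolding primitive_root_of_unity_def by (blast, blast intro: zero_less_one)
  then have "(1 - z) * (\<Sum>k<n. z ^ k) = 0" "1 - z \<noteq> 0"
    by (auto simp: one_diff_power_eq [symmetric])
  then show ?thesis by simp
qed

section \<open>Testing derivations on powers of \<zeta>\<close>

theorem theorem3p8:
  fixes p :: nat and \<zeta> :: complex and K OK :: "complex set"
    and \<sigma> \<tau> D :: "complex \<Rightarrow> complex"
  assumes "Factorial_Ring.prime p" and "odd p"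
    and "primitive_root_of_unity p \<zeta>"
    and "K = rat_adjoin \<zeta>"
    and "OK = ring_of_integers K"
    and "ring_endomorphism_on OK \<sigma>" and "\<exists>x\<in>OK. \<sigma> x \<noteq> 0"
    and "ring_endomorphism_on OK \<tau>" and "\<exists>x\<in>OK. \<tau> x \<noteq> 0"
    and "\<exists>x\<in>OK. \<sigma> x \<noteq> \<tau> x"
    and "int_linear_on OK D" and "D 1 = 0"
  shows "twisted_derivation_on OK \<sigma> \<tau> D \<longleftrightarrow>
    (\<forall>k\<in>{1..p - 2}. D (\<zeta> ^ k) =
      (\<Sum>(i, j)\<in>pairs_with_sum (k - 1). \<sigma> (\<zeta> ^ i) * \<tau> (\<zeta> ^ j)) * D \<zeta>)"
proof -
  have p: "2 \<le> p" using assms(1) by (rule prime_ge_2_nat)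
  have zp: "\<zeta> ^ p = 1" using assms(3) by (simp add: primitive_root_of_unity_def)
  \<comment> \<open>The monic polynomial \<open>monom 1 p\<close> takes the algebraic integer value
    1 at \<zeta>.\<close>
  have alg: "algebraic_int \<zeta>"
    by (rule algebraic_int_root[of 1 "monom 1 p"])
      (use p zp in \<open>auto simp: poly_monom degree_monom_eq\<close>)
  note R = assms(4,5)
  have one: "1 \<in> OK" and z: "\<zeta> \<in> OK"
    unfolding R by (auto intro: ring_of_integers_one ring_of_integers_gen alg)
  have add: "x + y \<in> OK" and mult: "x * y \<in> OK" if "x \<in> OK" "y \<in> OK" for x y
    using that unfolding R by (auto intro: ring_of_integers_add ring_of_integers_mult)
  have neg: "- x \<in> OK" if "x \<in> OK" for x
    using that unfolding R by (rule ring_of_integers_uminus)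
  have zero: "0 \<in> OK" using add[OF one neg[OF one]] by simp
  have int: "of_int n \<in> OK" for n
  proof (induction n rule: int_induct[where k = 0])
    case (step2 i)
    then show ?case using add[OF _ neg[OF one]] by fastforce
  qed (use zero one add in auto)
  have sub: "zmod.subspace OK"
    unfolding zmod.subspace_def using zero add mult int by blast
  have pow: "\<zeta> ^ k \<in> OK" for k
    by (induction k) (use one z mult in auto)
  have denom: "\<exists>n::int. n \<noteq> 0 \<and> of_int n * x \<in> zmod.span (range ((^) \<zeta>))" if "x \<in> OK" for x
    using that rat_adjoin_denominator[OF alg] by (auto simp: R ring_of_integers_def)
  note agree = int_linear_on_agree[OF sub _ _ _ _ _ denom]

  have lin: "int_linear_on OK \<sigma>" "int_linear_on OK \<tau>"
    using ring_endomorphism_on_int_linear[OF sub] assms by auto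
  define a where "a = \<sigma> \<zeta>"
  define b where "b = \<tau> \<zeta>"
  have "\<sigma> 1 = 1" "\<tau> 1 = 1"
    using ring_endomorphism_on_one[OF _ one] assms by auto
  then have \<sigma>_pow: "\<sigma> (\<zeta> ^ k) = a ^ k" and \<tau>_pow: "\<tau> (\<zeta> ^ k) = b ^ k" for k
    unfolding a_def b_def using ring_endomorphism_on_power[OF _ _ z pow] assms by auto
  \<comment> \<open>If \<open>a = b\<close>, then \<sigma> and \<tau> agree on all powers of
    \<zeta>, hence on \<open>OK\<close>.\<close>
  have "a \<noteq> b"
  proof
    assume "a = b"
    have "\<sigma> x = \<tau> x" if "x \<in> OK" for x
      by (rule agree[OF lin _ _ that that]) (use pow \<open>a = b\<close> in \<open>auto simp: \<sigma>_pow \<tau>_pow\<close>)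
    then show False using assms(10) by blast
  qed

  let ?prop = "\<lambda>x. (a - b) * D x = (\<sigma> x - \<tau> x) * D \<zeta>"
  \<comment> \<open>For \<open>k\<close> at least 1, the pairs of sum \<open>k - 1\<close> give
    exactly \<open>a ^ k - b ^ k\<close> after multiplication by the nonzero
    \<open>a - b\<close>.\<close>
  have formula: "D (\<zeta> ^ k) = (\<Sum>(i, j)\<in>pairs_with_sum (k - 1). \<sigma> (\<zeta> ^ i) * \<tau> (\<zeta> ^ j)) * D \<zeta>
      \<longleftrightarrow> ?prop (\<zeta> ^ k)" if "1 \<le> k" for k
  proof -
    define s where "s = (\<Sum>(i, j)\<in>pairs_with_sum (k - 1). a ^ i * b ^ j)"
    have "(a - b) * s = a ^ k - b ^ k"
      using pairs_with_sum_diff_power[of a b "k - 1"] that by (simp add: s_def)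
    then have "?prop (\<zeta> ^ k) \<longleftrightarrow> (a - b) * D (\<zeta> ^ k) = (a - b) * (s * D \<zeta>)"
      by (simp add: \<sigma>_pow \<tau>_pow mult.assoc [symmetric])
    with \<open>a \<noteq> b\<close> show ?thesis by (simp add: \<sigma>_pow \<tau>_pow s_def)
  qed

  have "(\<forall>k\<in>{1..p - 2}. ?prop (\<zeta> ^ k)) \<longleftrightarrow> (\<forall>x\<in>OK. ?prop x)"
  proof
    assume low: "\<forall>k\<in>{1..p - 2}. ?prop (\<zeta> ^ k)"
    \<comment> \<open>The identity \<open>?prop\<close> becomes equality of two integer-linear maps
      on \<open>OK\<close>, to which the agreement lemma applies.\<close>
    define f where "f = (\<lambda>x. (a - b) * D x)"
    define g where "g = (\<lambda>x. (\<sigma> x - \<tau> x) * D \<zeta>)"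
    have cl: "\<sigma> x \<in> OK" "\<tau> x \<in> OK" "D x \<in> OK" if "x \<in> OK" for x
      using that lin assms(11) by (auto simp: int_linear_on_def)
    have diff: "x - y \<in> OK" if "x \<in> OK" "y \<in> OK" for x y
      using add[OF that(1) neg[OF that(2)]] by simp
    have f: "int_linear_on OK f"
    proof -
      have "f \<in> OK \<rightarrow> OK"
        unfolding f_def a_def b_def by (intro Pi_I mult diff cl z)
      then show ?thesis
        using assms(11) by (simp add: int_linear_on_def f_def distrib_left)
    qed
    have g: "int_linear_on OK g"
    proof -
      have "g \<in> OK \<rightarrow> OK"
        unfolding g_def by (intro Pi_I mult diff cl z)
      then show ?thesis
        using lin by (simp add: int_linear_on_def g_def algebra_simps)
    qed
    \<comment> \<open>The exponent 0 lies outside the assumed range; there both sides vanish by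
      \<open>D 1 = 0\<close> and \<open>\<sigma> 1 = \<tau> 1\<close>.\<close>
    have small: "f (\<zeta> ^ k) = g (\<zeta> ^ k)" if "k < p - 1" for k
    proof (cases "k = 0")
      case True
      then show ?thesis
        using assms(12) \<open>\<sigma> 1 = 1\<close> \<open>\<tau> 1 = 1\<close> by (simp add: f_def g_def)
    next
      case False
      then show ?thesis using low that by (simp add: f_def g_def)
    qed
    have "\<zeta> ^ (p - 1) = - (\<Sum>k<p - 1. \<zeta> ^ k)"
    proof -
      have "(\<Sum>k<Suc (p - 1). \<zeta> ^ k) = 0"
        using primitive_root_of_unity_sum_powers[OF assms(3)] p by simp
      then show ?thesis by (simp add: add_eq_0_iff)
    qed
    moreover have "(\<Sum>k<p - 1. \<zeta> ^ k) \<in> zmod.span ((^) \<zeta> ` {..<p - 1})"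
      by (intro zmod.span_sum zmod.span_base) auto
    \<comment> \<open>The factor \<open>of_int 1\<close> puts this in the shape of the agreement
      lemma, with 1 as the nonzero integer.\<close>
    ultimately have low_span: "of_int 1 * \<zeta> ^ (p - 1) \<in> zmod.span ((^) \<zeta> ` {..<p - 1})"
      by (simp add: zmod.span_neg)
    have top: "f (\<zeta> ^ (p - 1)) = g (\<zeta> ^ (p - 1))"
    proof (rule int_linear_on_agree[OF sub f g _ _ pow])
      show "\<exists>n::int. n \<noteq> 0 \<and> of_int n * \<zeta> ^ (p - 1) \<in> zmod.span ((^) \<zeta> ` {..<p - 1})"
        using low_span one_neq_zero by blast
    qed (use small pow in auto)
    have "f (\<zeta> ^ k) = g (\<zeta> ^ k)" for k
    proof -
      \<comment> \<open>Every exponent reduces to a residue modulo \<open>p\<close>, which is either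
        below \<open>p - 1\<close> or equal to it.\<close>
      have "\<zeta> ^ k = \<zeta> ^ (k mod p)"
        using zp power_add[of \<zeta> "p * (k div p)" "k mod p"] by (simp add: power_mult)
      moreover have "k mod p < p - 1 \<or> k mod p = p - 1"
        using p mod_less_divisor[of p k] by linarith
      ultimately show ?thesis using small top by metis
    qed
    then have "f x = g x" if "x \<in> OK" for x
      using agree[OF f g _ _ that that] pow by blast
    then show "\<forall>x\<in>OK. ?prop x" by (simp add: f_def g_def)
  qed (use pow in auto)
  moreover have "twisted_derivation_on OK \<sigma> \<tau> D \<longleftrightarrow> (\<forall>x\<in>OK. ?prop x)"
    unfolding a_def b_def
    by (rule twisted_derivation_on_iff_proportional[OF assms(6,8,11) z _ mult])
      (use \<open>a \<noteq> b\<close> in \<open>simp_all add: a_def b_def\<close>)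
  ultimately show ?thesis using formula by auto
qed

end
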